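(* Let $f\colon\omega\to\omega$ be a total recursive proper quasi-block function which has a computable non-decreasing lower bound diverging to $+\infty$, i.e. there is a computable non-decreasing $h\colon\omega\to\omega$ with $h(n)\le f(n)$ for all $n$ and $\lim_n h(n)=+\infty$. Then the degree spectrum of $f$ on $(\omega,<)$ consists of exactly the c.e. Turing degrees.
   Context: $f$ is a quasi-block function if there are arbitrarily long finite initial segments of $(\omega,<)$ closed under $f$. $f$ is a block function if for every $a\in\omega$ there is a finite interval $I$ of $(\omega,<)$ containing $a$ that is closed under $f$ and under $f^{-1}$ (for $x\in I$: $f(x)\in I$ and $f^{-1}(x)\subseteq I$). A proper quasi-block function is a quasi-block function that is not a block function. A computable copy of $(\omega,<)$ is $(\omega,\prec)$ with $\prec$ computable and isomorphic to $(\omega,<)$; $f_{\mathcal A}$ is the image of the graph of $f$ in $\mathcal A$; the degree spectrum of $f$ is the set of degrees of $f_{\mathcal A}$ over all computable copies $\mathcal A$. *)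

theory Defs
  imports Complex_Main "HOL-Library.Nat_Bijection"
begin

text \<open>
  Kleene's \<open>\<mu>\<close>-recursive functions relative to an oracle set. Programs are not tagged with an arity;
  they act on argument lists, and a program applied to a list of unsuitable length simply has
  no value.
\<close>

datatype prog =
    Zero
  | Succ
  | Proj nat
  | Oracle
  | Comp prog "prog list"
  | PrimRec prog prog
  | Mu prog

inductive eval :: "nat set \<Rightarrow> prog \<Rightarrow> nat list \<Rightarrow> nat \<Rightarrow> bool" for A :: "nat set" where
  Zero: "eval A Zero xs 0"
| Succ: "eval A Succ [x] (Suc x)"
| Proj: "i < length xs \<Longrightarrow> eval A (Proj i) xs (xs ! i)"
| Oracle: "eval A Oracle [x] (of_bool (x \<in> A))"
| Comp: "list_all2 (\<lambda>q y. eval A q xs y) qs ys \<Longrightarrow> eval A p ys z \<Longrightarrow> eval A (Comp p qs) xs z"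
| PrimRec_0: "eval A p xs y \<Longrightarrow> eval A (PrimRec p q) (0 # xs) y"
| PrimRec_Suc: "eval A (PrimRec p q) (n # xs) r \<Longrightarrow> eval A q (n # r # xs) y \<Longrightarrow>
    eval A (PrimRec p q) (Suc n # xs) y"
| Mu: "eval A p (n # xs) 0 \<Longrightarrow> (\<forall>m<n. \<exists>k. eval A p (m # xs) (Suc k)) \<Longrightarrow> eval A (Mu p) xs n"

text \<open>Evaluation is single-valued, so every program denotes a partial function.\<close>

lemma eval_deterministic: "eval A p xs y \<Longrightarrow> eval A p xs z \<Longrightarrow> y = z"
proof (induction arbitrary: z rule: eval.induct)
  case (Comp xs qs ys p w)
  from Comp.prems obtain ys' where ys': "list_all2 (\<lambda>q y. eval A q xs y) qs ys'"
    and z: "eval A p ys' z" by (auto elim: eval.cases)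
  have "ys = ys'"
    using Comp.IH(1) ys' by (auto simp: list_all2_conv_all_nth intro: nth_equalityI)
  with z Comp.IH(2) show ?case by blast
next
  case (PrimRec_0 p xs y q)
  from PrimRec_0.prems have "eval A p xs z" by (auto elim: eval.cases)
  with PrimRec_0.IH show ?case by blast
next
  case (PrimRec_Suc p q n xs r y)
  from PrimRec_Suc.prems obtain r' where "eval A (PrimRec p q) (n # xs) r'"
    "eval A q (n # r' # xs) z" by (auto elim: eval.cases)
  with PrimRec_Suc.IH show ?case by blast
next
  case (Mu p n xs)
  from Mu.prems have z: "eval A p (z # xs) 0" "\<forall>m<z. \<exists>k. eval A p (m # xs) (Suc k)"
    by (auto elim: eval.cases)
  show ?case
  proof (rule linorder_cases[of n z])
    assume "n < z"
    with z(2) Mu.IH(1) show ?thesis by fastforce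
  next
    assume "z < n"
    with z(1) Mu.IH(2) show ?thesis by fastforce
  qed
qed (auto elim: eval.cases)

definition turing_le :: "nat set \<Rightarrow> nat set \<Rightarrow> bool" (infix "\<le>\<^sub>T" 50) where
  "B \<le>\<^sub>T A \<longleftrightarrow> (\<exists>p. \<forall>x. eval A p [x] (of_bool (x \<in> B)))"

definition turing_degree :: "nat set \<Rightarrow> nat set set" where
  "turing_degree A = {B. A \<le>\<^sub>T B \<and> B \<le>\<^sub>T A}"

text \<open>Absolute computability is computability with the empty oracle.\<close>

definition computable_fun :: "(nat \<Rightarrow> nat) \<Rightarrow> bool" where
  "computable_fun f \<longleftrightarrow> (\<exists>p. \<forall>x. eval {} p [x] (f x))"

definition computable_rel :: "(nat \<Rightarrow> nat \<Rightarrow> bool) \<Rightarrow> bool" where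
  "computable_rel R \<longleftrightarrow> (\<exists>p. \<forall>x y. eval {} p [x, y] (of_bool (R x y)))"

definition ce :: "nat set \<Rightarrow> bool" where
  "ce W \<longleftrightarrow> W = {} \<or> (\<exists>g. computable_fun g \<and> W = range g)"

definition ce_degrees :: "nat set set set" where
  "ce_degrees = turing_degree ` {W. ce W}"

definition quasi_block :: "(nat \<Rightarrow> nat) \<Rightarrow> bool" where
  "quasi_block f \<longleftrightarrow> (\<forall>n. \<exists>m\<ge>n. f ` {..<m} \<subseteq> {..<m})"

definition block :: "(nat \<Rightarrow> nat) \<Rightarrow> bool" where
  "block f \<longleftrightarrow> (\<forall>a. \<exists>l u. a \<in> {l..u} \<and> (\<forall>x\<in>{l..u}. f x \<in> {l..u} \<and> f -` {x} \<subseteq> {l..u}))"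

definition proper_quasi_block :: "(nat \<Rightarrow> nat) \<Rightarrow> bool" where
  "proper_quasi_block f \<longleftrightarrow> quasi_block f \<and> \<not> block f"

definition order_iso :: "(nat \<Rightarrow> nat) \<Rightarrow> (nat \<Rightarrow> nat \<Rightarrow> bool) \<Rightarrow> bool" where
  "order_iso \<pi> lt \<longleftrightarrow> bij \<pi> \<and> (\<forall>x y. x < y \<longleftrightarrow> lt (\<pi> x) (\<pi> y))"

definition computable_copy :: "(nat \<Rightarrow> nat \<Rightarrow> bool) \<Rightarrow> bool" where
  "computable_copy lt \<longleftrightarrow> computable_rel lt \<and> (\<exists>\<pi>. order_iso \<pi> lt)"

text \<open>
  The graph is a binary relation; it is turned into a set of numbers by the standard pairing
  so that it can serve as an oracle and has a Turing degree.
\<close>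

definition graph_image :: "(nat \<Rightarrow> nat) \<Rightarrow> (nat \<Rightarrow> nat) \<Rightarrow> nat set" where
  "graph_image \<pi> f = {prod_encode (\<pi> x, \<pi> (f x)) | x. True}"

text \<open>
  The isomorphism from the standard order onto a copy is unique, so each copy contributes
  exactly one degree.
\<close>

definition degree_spectrum :: "(nat \<Rightarrow> nat) \<Rightarrow> nat set set set" where
  "degree_spectrum f =
    {turing_degree (graph_image \<pi> f) | \<pi> lt. computable_copy lt \<and> order_iso \<pi> lt}"

end

(* A copy of (omega, <) is determined up to Turing equivalence by its rank function, the inverse of
   the isomorphism pi, and the rank function is equivalent to the set of pairs (x, a) with
   x < rank a, which is c.e. because rank a is the limit of the nondecreasing computable
   approximations counting the predecessors of a among 0, ..., s - 1. The image of the graph of f is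
   computable from rank. Conversely, with the graph as an oracle one searches for a stage s at which
   the approximate ranks commute with f on a long closed initial segment of length k; the true ranks
   of the approximate initial segment then give a strictly increasing S with S x >= x commuting
   with f, and finitely many values of S can be fixed in advance. If S moves a point up to h k, let m
   be the least one. Then m is closed under f, and since f is not a block function,
   X = {x. m <= x, f x < m} is nonempty; it is contained in {..<k} because h k >= m. But S maps X into
   itself and moves its maximum up, a contradiction. So the ranks up to h k are the true ones.

   It remains to realise the degree of a c.e. set range g as that of a rank function: put 2n in
   block n, and put 2s + 1 in block g s if g s is enumerated for the first time at s, and in
   block s otherwise. *)
theory Submission
  imports Defs
begin

subsection \<open>Closure properties of recursive functions\<close>

text \<open>
  The list \<open>vs\<close> holds the variables in scope, as functions of an environment of arbitrary type. A
  binder extends the environment to a pair and the list to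
  \<open>snd # map (\<lambda>v p. v (fst p)) vs\<close>, so that recursiveness of a concrete term is shown by resolution.
\<close>

definition recfun :: "nat set \<Rightarrow> ('e \<Rightarrow> nat) list \<Rightarrow> ('e \<Rightarrow> nat) \<Rightarrow> bool" where
  "recfun A vs F \<longleftrightarrow> (\<exists>p. \<forall>e. eval A p (map (\<lambda>v. v e) vs) (F e))"

definition recpred :: "nat set \<Rightarrow> ('e \<Rightarrow> nat) list \<Rightarrow> ('e \<Rightarrow> bool) \<Rightarrow> bool" where
  "recpred A vs P \<longleftrightarrow> recfun A vs (\<lambda>e. of_bool (P e))"

section \<open>Change of oracle and Turing reducibility\<close>

fun replace_oracle :: "prog \<Rightarrow> prog \<Rightarrow> prog" where
  "replace_oracle q Zero = Zero"
| "replace_oracle q Succ = Succ"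
| "replace_oracle q (Proj i) = Proj i"
| "replace_oracle q Oracle = q"
| "replace_oracle q (Comp p ps) = Comp (replace_oracle q p) (map (replace_oracle q) ps)"
| "replace_oracle q (PrimRec p p') = PrimRec (replace_oracle q p) (replace_oracle q p')"
| "replace_oracle q (Mu p) = Mu (replace_oracle q p)"

text \<open>Each oracle call is answered by running \<open>q\<close>, which decides \<open>B\<close>
  from \<open>A\<close>. This is what makes Turing reducibility transitive and lets absolutely
  computable functions be used with any oracle.\<close>

lemma eval_replace_oracle:
  assumes "eval B p xs y" and "\<And>x. eval A q [x] (of_bool (x \<in> B))"
  shows "eval A (replace_oracle q p) xs y"
  using assms(1)
proof (induction rule: eval.induct)
  case (Comp xs qs ys p z)
  then show ?case
    by (auto intro!: eval.Comp simp: list_all2_map1 elim: list_all2_mono)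
next
  case (Mu p n xs)
  then show ?case by (auto intro!: eval.Mu)
qed (simp_all add: eval.intros assms(2))

lemma recfun_oracle_trans:
  assumes "recfun B vs F" and "B \<le>\<^sub>T A"
  shows "recfun A vs F"
  using assms eval_replace_oracle unfolding recfun_def turing_le_def by metis

lemma empty_turing_le: "{} \<le>\<^sub>T A"
  unfolding turing_le_def using eval.Zero by fastforce

lemma turing_le_iff: "B \<le>\<^sub>T A \<longleftrightarrow> recpred A [\<lambda>x. x] (\<lambda>x. x \<in> B)"
  by (simp add: turing_le_def recpred_def recfun_def)

lemma turing_le_trans: "C \<le>\<^sub>T B \<Longrightarrow> B \<le>\<^sub>T A \<Longrightarrow> C \<le>\<^sub>T A"
  unfolding turing_le_iff[of C] recpred_def by (rule recfun_oracle_trans)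

lemma turing_degree_eqI:
  assumes "A \<le>\<^sub>T B" "B \<le>\<^sub>T A"
  shows "turing_degree A = turing_degree B"
  unfolding turing_degree_def using assms turing_le_trans by blast

section \<open>Composition, primitive recursion, arithmetic, bounded quantifiers and search\<close>

lemma recfun_var: "v \<in> set vs \<Longrightarrow> recfun A vs v"
proof -
  assume "v \<in> set vs"
  then obtain i where i: "i < length vs" "vs ! i = v" by (auto simp: in_set_conv_nth)
  have "eval A (Proj i) (map (\<lambda>v. v e) vs) (v e)" for e
    using eval.Proj[of i "map (\<lambda>v. v e) vs" A] i by simp
  then show ?thesis unfolding recfun_def by blast
qed

text \<open>Composition, stated as a change of environment along \<open>g\<close>. Taking for
  \<open>g\<close> a map that builds a tuple gives the rules for functions of fixed arity; taking a
  projection gives weakening to a larger scope.\<close>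

lemma recfun_subst:
  assumes F: "recfun A vs F" and vs: "\<forall>v\<in>set vs. recfun A ws (\<lambda>d. v (g d))"
  shows "recfun A ws (\<lambda>d. F (g d))"
proof -
  obtain p where p: "\<And>e. eval A p (map (\<lambda>v. v e) vs) (F e)"
    using F unfolding recfun_def by blast
  have "\<forall>v\<in>set vs. \<exists>q. \<forall>d. eval A q (map (\<lambda>w. w d) ws) (v (g d))"
    using vs unfolding recfun_def by blast
  then obtain q where q: "\<And>v d. v \<in> set vs \<Longrightarrow> eval A (q v) (map (\<lambda>w. w d) ws) (v (g d))"
    by metis
  have "eval A (Comp p (map q vs)) (map (\<lambda>w. w d) ws) (F (g d))" for d
    by (rule eval.Comp[OF _ p[of "g d"]]) (auto simp: list_all2_conv_all_nth q)
  then show ?thesis unfolding recfun_def by blast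
qed

lemma recfun_comp1:
  assumes "recfun A [\<lambda>x. x] f" "recfun A vs X"
  shows "recfun A vs (\<lambda>e. f (X e))"
  using recfun_subst[OF assms(1), of vs X] assms(2) by simp

lemma recfun_comp2:
  assumes "recfun A [fst, snd] (\<lambda>e. f (fst e) (snd e))" "recfun A vs X" "recfun A vs Y"
  shows "recfun A vs (\<lambda>e. f (X e) (Y e))"
  using recfun_subst[OF assms(1), of vs "\<lambda>e. (X e, Y e)"] assms(2,3) by simp

lemma recpred_comp2:
  assumes "recpred A [fst, snd] (\<lambda>e. P (fst e) (snd e))" "recfun A vs X" "recfun A vs Y"
  shows "recpred A vs (\<lambda>e. P (X e) (Y e))"
  using assms unfolding recpred_def by (rule recfun_comp2)

lemma recfun_Suc: "recfun A vs X \<Longrightarrow> recfun A vs (\<lambda>e. Suc (X e))"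
  by (rule recfun_comp1[of _ Suc]) (auto simp: recfun_def intro: eval.Succ)

lemma recfun_const: "recfun A vs (\<lambda>e. c)"
proof (induction c)
  case 0
  show ?case unfolding recfun_def using eval.Zero by blast
qed (rule recfun_Suc)

text \<open>The step function sees the counter, the previous value and then the outer variables, in
  the order in which \<open>PrimRec\<close> passes them.\<close>

lemma recfun_primrec:
  assumes B: "recfun A vs B"
    and S: "recfun A ((fst \<circ> snd) # (snd \<circ> snd) # map (\<lambda>v p. v (fst p)) vs)
      (\<lambda>p. S (fst p) (fst (snd p)) (snd (snd p)))"
    and N: "recfun A vs N"
  shows "recfun A vs (\<lambda>e. rec_nat (B e) (S e) (N e))"
proof -
  obtain p where p: "\<And>e. eval A p (map (\<lambda>v. v e) vs) (B e)"
    using B unfolding recfun_def by blast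
  obtain q where q: "\<And>e i r. eval A q (i # r # map (\<lambda>v. v e) vs) (S e i r)"
    using S unfolding recfun_def by (auto simp: comp_def)
  have "eval A (PrimRec p q) (n # map (\<lambda>v. v e) vs) (rec_nat (B e) (S e) n)" for n e
    by (induction n) (auto intro: eval.intros p q)
  then have "recfun A (snd # map (\<lambda>v p. v (fst p)) vs) (\<lambda>p. rec_nat (B (fst p)) (S (fst p)) (snd p))"
    unfolding recfun_def by (auto simp: comp_def)
  from recfun_subst[OF this, of vs "\<lambda>e. (e, N e)"] N show ?thesis
    by (simp add: recfun_var)
qed

lemma recfun_add:
  assumes "recfun A vs X" "recfun A vs Y"
  shows "recfun A vs (\<lambda>e. X e + Y e)"
proof (rule recfun_comp2[OF _ assms])
  have "rec_nat x (\<lambda>_. Suc) y = x + y" for x y by (induction y) auto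
  moreover have "recfun A [fst, snd] (\<lambda>e. rec_nat (fst e) (\<lambda>_. Suc) (snd e))"
    by (intro recfun_primrec recfun_Suc recfun_var) auto
  ultimately show "recfun A [fst, snd] (\<lambda>e. fst e + snd e)" by simp
qed

lemma recfun_diff:
  assumes "recfun A vs X" "recfun A vs Y"
  shows "recfun A vs (\<lambda>e. X e - Y e)"
proof (rule recfun_comp2[OF _ assms])
  \<comment> \<open>The predecessor is a recursion that drops the previous value and returns its
    counter; truncated subtraction iterates it.\<close>
  have "rec_nat 0 (\<lambda>i r. i) x = x - 1" for x by (cases x) auto
  moreover have "recfun A [\<lambda>x. x] (\<lambda>x. rec_nat 0 (\<lambda>i r. i) x)"
    by (intro recfun_primrec recfun_const recfun_var) (auto simp: comp_def)
  ultimately have pred: "recfun A [\<lambda>x. x] (\<lambda>x. x - 1)" by simp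
  have "rec_nat x (\<lambda>_ r. r - 1) y = x - y" for x y by (induction y) auto
  moreover have "recfun A [fst, snd] (\<lambda>e. rec_nat (fst e) (\<lambda>_ r. r - 1) (snd e))"
    by (intro recfun_primrec recfun_comp1[OF pred] recfun_var) (auto simp: comp_def)
  ultimately show "recfun A [fst, snd] (\<lambda>e. fst e - snd e)" by simp
qed

lemma recfun_sum:
  assumes F: "recfun A (snd # map (\<lambda>v p. v (fst p)) vs) (\<lambda>p. F (fst p) (snd p))"
    and N: "recfun A vs N"
  shows "recfun A vs (\<lambda>e. \<Sum>i<N e. F e i)"
proof -
  have "recfun A ((fst \<circ> snd) # (snd \<circ> snd) # map (\<lambda>v p. v (fst p)) vs)
      (\<lambda>p. snd (snd p) + F (fst p) (fst (snd p)))"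
    using recfun_subst[OF F, of "(fst \<circ> snd) # (snd \<circ> snd) # map (\<lambda>v p. v (fst p)) vs"
        "\<lambda>p. (fst p, fst (snd p))"]
    by (intro recfun_add) (simp_all add: comp_def recfun_var)
  from recfun_primrec[OF recfun_const[of _ _ 0] this N]
  have "recfun A vs (\<lambda>e. rec_nat 0 (\<lambda>i r. r + F e i) (N e))" .
  moreover have "rec_nat 0 (\<lambda>i r. r + F e i) n = (\<Sum>i<n. F e i)" for e n
    by (induction n) auto
  ultimately show ?thesis by simp
qed

lemma recpred_less:
  assumes "recfun A vs X" "recfun A vs Y"
  shows "recpred A vs (\<lambda>e. X e < Y e)"
proof -
  have "1 - (Suc x - y) = of_bool (x < y)" for x y :: nat by auto
  moreover have "recfun A vs (\<lambda>e. 1 - (Suc (X e) - Y e))"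
    by (intro recfun_diff recfun_const recfun_Suc assms)
  ultimately show ?thesis unfolding recpred_def by simp
qed

lemma recpred_not:
  assumes "recpred A vs P"
  shows "recpred A vs (\<lambda>e. \<not> P e)"
proof -
  have "1 - of_bool b = (of_bool (\<not> b) :: nat)" for b by auto
  moreover have "recfun A vs (\<lambda>e. 1 - of_bool (P e))"
    using assms unfolding recpred_def by (intro recfun_diff recfun_const)
  ultimately show ?thesis unfolding recpred_def by simp
qed

lemma recpred_conj:
  assumes "recpred A vs P" "recpred A vs Q"
  shows "recpred A vs (\<lambda>e. P e \<and> Q e)"
proof -
  have "of_bool b + of_bool c - 1 = (of_bool (b \<and> c) :: nat)" for b c by auto
  moreover have "recfun A vs (\<lambda>e. of_bool (P e) + of_bool (Q e) - 1)"
    using assms unfolding recpred_def by (intro recfun_diff recfun_add recfun_const)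
  ultimately show ?thesis unfolding recpred_def by simp
qed

lemma recpred_disj:
  assumes "recpred A vs P" "recpred A vs Q"
  shows "recpred A vs (\<lambda>e. P e \<or> Q e)"
  using recpred_not[OF recpred_conj[OF assms[THEN recpred_not]]] by simp

lemma recpred_imp:
  assumes "recpred A vs P" "recpred A vs Q"
  shows "recpred A vs (\<lambda>e. P e \<longrightarrow> Q e)"
  using recpred_disj[OF recpred_not[OF assms(1)] assms(2)] by (simp only: imp_conv_disj)

lemma recpred_le:
  assumes "recfun A vs X" "recfun A vs Y"
  shows "recpred A vs (\<lambda>e. X e \<le> Y e)"
  using recpred_less[OF assms(1) recfun_Suc[OF assms(2)]] by (simp add: less_Suc_eq_le)

lemma recpred_eq:
  assumes "recfun A vs X" "recfun A vs Y"
  shows "recpred A vs (\<lambda>e. X e = Y e)"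
  using recpred_conj[OF recpred_le[OF assms] recpred_le[OF assms(2,1)]]
  by (simp add: order_eq_iff)

text \<open>A bounded existential statement holds iff the sum of the truth values of its instances
  is positive.\<close>

lemma recpred_bex:
  assumes P: "recpred A (snd # map (\<lambda>v p. v (fst p)) vs) (\<lambda>p. P (fst p) (snd p))"
    and N: "recfun A vs N"
  shows "recpred A vs (\<lambda>e. \<exists>i<N e. P e i)"
proof -
  have "recfun A vs (\<lambda>e. \<Sum>i<N e. of_bool (P e i))"
    using P unfolding recpred_def by (rule recfun_sum[OF _ N])
  from recpred_less[OF recfun_const[of _ _ 0] this] show ?thesis
    by (simp add: Bex_def Int_def set_eq_iff flip: neq0_conv)
qed

lemma recpred_ball:
  assumes P: "recpred A (snd # map (\<lambda>v p. v (fst p)) vs) (\<lambda>p. P (fst p) (snd p))"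
    and N: "recfun A vs N"
  shows "recpred A vs (\<lambda>e. \<forall>i<N e. P e i)"
  using recpred_not[OF recpred_bex[OF recpred_not[OF P] N]] by simp

text \<open>\<open>Mu\<close> looks for a zero, so it is applied to the truth value of the negation;
  \<open>ex\<close> makes the search end for every environment.\<close>

lemma recfun_Least:
  assumes P: "recpred A (snd # map (\<lambda>v p. v (fst p)) vs) (\<lambda>p. P (fst p) (snd p))"
    and ex: "\<And>e. \<exists>n. P e n"
  shows "recfun A vs (\<lambda>e. LEAST n. P e n)"
proof -
  obtain p where "\<And>e. eval A p (map (\<lambda>v. v e) (snd # map (\<lambda>v p. v (fst p)) vs))
      (of_bool (\<not> P (fst e) (snd e)))"
    using recpred_not[OF P] unfolding recpred_def recfun_def by blast
  from this[of "(e, n)" for e n]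
  have p: "eval A p (n # map (\<lambda>v. v e) vs) (of_bool (\<not> P e n))" for e n
    by (simp add: comp_def)
  have "eval A (Mu p) (map (\<lambda>v. v e) vs) (LEAST n. P e n)" for e
  proof (rule eval.Mu)
    show "eval A p ((LEAST n. P e n) # map (\<lambda>v. v e) vs) 0"
      using p[of "LEAST n. P e n" e] LeastI_ex[OF ex[of e]] by simp
    show "\<forall>m<LEAST n. P e n. \<exists>k. eval A p (m # map (\<lambda>v. v e) vs) (Suc k)"
      using p[of _ e] not_less_Least[of _ "P e"] by (metis One_nat_def of_bool_eq(2))
  qed
  then show ?thesis unfolding recfun_def by blast
qed

lemma recpred_oracle:
  assumes "recfun A vs X"
  shows "recpred A vs (\<lambda>e. X e \<in> A)"
  unfolding recpred_def
proof (rule recfun_comp1[OF _ assms])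
  show "recfun A [\<lambda>x. x] (\<lambda>x. of_bool (x \<in> A))"
    unfolding recfun_def using eval.Oracle[of A] by (intro exI[of _ Oracle]) simp
qed

lemmas rec_intros = recfun_const recfun_Suc recfun_add recfun_diff recfun_sum recpred_less
  recpred_not recpred_conj recpred_disj recpred_imp recpred_le recpred_eq recpred_bex
  recpred_ball recpred_oracle

section \<open>Pairing, definition by cases, and computable functions with an arbitrary
  oracle\<close>

lemma recfun_prod_encode:
  assumes "recfun A vs X" "recfun A vs Y"
  shows "recfun A vs (\<lambda>e. prod_encode (X e, Y e))"
proof (rule recfun_comp2[OF _ assms])
  \<comment> \<open>The sum avoids the division by 2 in the closed form.\<close>
  have "triangle n = (\<Sum>i<n. Suc i)" for n by (induction n) auto
  then show "recfun A [fst, snd] (\<lambda>e. prod_encode (fst e, snd e))"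
    by (simp only: prod_encode_def prod.case) (intro rec_intros; (rule recfun_var, simp))
qed

lemma recfun_fst_prod_decode:
  assumes "recfun A vs X"
  shows "recfun A vs (\<lambda>e. fst (prod_decode (X e)))"
proof (rule recfun_comp1[OF _ assms])
  \<comment> \<open>A component of a pair is at most the code of the pair, so the search for
    \<open>b\<close> can be bounded by \<open>z\<close>.\<close>
  have dec: "fst (prod_decode z) = (LEAST a. \<exists>b<Suc z. prod_encode (a, b) = z)" for z
  proof (rule Least_equality[symmetric])
    show "\<exists>b<Suc z. prod_encode (fst (prod_decode z), b) = z"
      by (rule exI[of _ "snd (prod_decode z)"])
        (metis le_imp_less_Suc le_prod_encode_2 prod.collapse prod_decode_inverse)
  qed auto
  have "recfun A [\<lambda>x. x] (\<lambda>z. LEAST a. \<exists>b<Suc z. prod_encode (a, b) = z)"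
    by (rule recfun_Least, intro rec_intros recfun_prod_encode; (rule recfun_var, simp)?)
      (metis le_imp_less_Suc le_prod_encode_2 prod.collapse prod_decode_inverse)
  then show "recfun A [\<lambda>x. x] (\<lambda>z. fst (prod_decode z))" by (simp add: dec)
qed

lemma recfun_snd_prod_decode:
  assumes "recfun A vs X"
  shows "recfun A vs (\<lambda>e. snd (prod_decode (X e)))"
proof (rule recfun_comp1[OF _ assms])
  have dec: "snd (prod_decode z) = (LEAST b. prod_encode (fst (prod_decode z), b) = z)" for z
    by (rule Least_equality[symmetric]) (simp, metis eq_refl prod_encode_inverse snd_conv)
  have "recfun A [\<lambda>x. x] (\<lambda>z. LEAST b. prod_encode (fst (prod_decode z), b) = z)"
    by (rule recfun_Least, intro rec_intros recfun_prod_encode recfun_fst_prod_decode;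
        (rule recfun_var, simp)?) (metis prod.collapse prod_decode_inverse)
  then show "recfun A [\<lambda>x. x] (\<lambda>z. snd (prod_decode z))" by (simp add: dec)
qed

lemma recfun_if:
  assumes "recpred A vs P" "recfun A vs X" "recfun A vs Y"
  shows "recfun A vs (\<lambda>e. if P e then X e else Y e)"
proof -
  \<comment> \<open>A recursion of length 0 or 1, depending on the truth value.\<close>
  have "rec_nat y (\<lambda>_ _. x) (of_bool b) = (if b then x else y)" for x y :: nat and b by simp
  moreover have "recfun A vs (\<lambda>e. rec_nat (Y e) (\<lambda>_ _. X e) (of_bool (P e)))"
    using assms unfolding recpred_def
    by (intro recfun_primrec) (simp_all add: recfun_subst[OF assms(2), of _ fst] recfun_var)
  ultimately show ?thesis by simp
qed

lemma computable_fun_iff: "computable_fun f \<longleftrightarrow> recfun {} [\<lambda>x. x] f"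
  by (simp add: computable_fun_def recfun_def)

lemma computable_rel_iff:
  "computable_rel R \<longleftrightarrow> recpred {} [fst, snd] (\<lambda>e. R (fst e) (snd e))"
  by (simp add: computable_rel_def recpred_def recfun_def)

lemma recfun_computable:
  assumes "computable_fun f" "recfun A vs X"
  shows "recfun A vs (\<lambda>e. f (X e))"
  using assms recfun_oracle_trans[OF _ empty_turing_le] recfun_comp1
  unfolding computable_fun_iff by metis

lemma recpred_computable:
  assumes "computable_rel R" "recfun A vs X" "recfun A vs Y"
  shows "recpred A vs (\<lambda>e. R (X e) (Y e))"
proof (rule recpred_comp2[OF _ assms(2,3)])
  show "recpred A [fst, snd] (\<lambda>e. R (fst e) (snd e))"
    using assms(1) recfun_oracle_trans[OF _ empty_turing_le]
    unfolding computable_rel_iff recpred_def by blast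
qed

subsection \<open>Ranks in linear orders of type omega\<close>

definition rank_below :: "(nat \<Rightarrow> nat \<Rightarrow> bool) \<Rightarrow> nat \<Rightarrow> nat \<Rightarrow> nat" where
  "rank_below lt s a = card {b. b < s \<and> lt b a}"

lemma recfun_rank_below:
  assumes "computable_rel lt" "recfun A vs X" "recfun A vs Y"
  shows "recfun A vs (\<lambda>e. rank_below lt (X e) (Y e))"
proof (rule recfun_comp2[OF _ assms(2,3)])
  have "rank_below lt s a = (\<Sum>b<s. of_bool (lt b a))" for s a
    by (simp add: rank_below_def Int_def)
  moreover have "recfun A [fst, snd] (\<lambda>e. \<Sum>b<fst e. of_bool (lt b (snd e)))"
    by (intro recfun_sum recpred_computable[OF assms(1), unfolded recpred_def];
        (rule recfun_var, simp))
  ultimately show "recfun A [fst, snd] (\<lambda>e. rank_below lt (fst e) (snd e))" by simp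
qed

text \<open>Counting predecessors is strictly monotone, hence injective, and its values stay below
  \<open>card B\<close>; equal cardinalities then give surjectivity.\<close>

lemma bij_betw_card_below:
  assumes fin: "finite B" and lt: "irreflp lt" "transp lt" "totalp lt"
  shows "bij_betw (\<lambda>a. card {b \<in> B. lt b a}) B {..<card B}"
proof -
  let ?r = "\<lambda>a. card {b \<in> B. lt b a}"
  have less: "?r a < ?r c" if "a \<in> B" "lt a c" for a c
    using that irreflpD[OF lt(1), of a] transpD[OF lt(2), of _ a c]
    by (intro psubset_card_mono) (auto simp: fin)
  have inj: "inj_on ?r B"
  proof (rule inj_onI, rule ccontr)
    fix a c assume "a \<in> B" "c \<in> B" "?r a = ?r c" "a \<noteq> c"
    then show False using less[of a c] less[of c a] totalpD[OF lt(3), of a c] by auto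
  qed
  have "?r a < card B" if "a \<in> B" for a
    using that irreflpD[OF lt(1), of a] by (intro psubset_card_mono fin) auto
  then have "?r ` B \<subseteq> {..<card B}" by auto
  moreover have "card (?r ` B) = card B" by (rule card_image[OF inj])
  ultimately have "?r ` B = {..<card B}" by (intro card_subset_eq) auto
  with inj show ?thesis by (simp add: bij_betw_def)
qed

text \<open>The isomorphism is the inverse of the map counting predecessors. That map is injective,
  so its values are unbounded; to reach n, take an element of larger rank and apply the finite case
  to its predecessors.\<close>

lemma order_iso_exists:
  fixes lt :: "nat \<Rightarrow> nat \<Rightarrow> bool"
  assumes lt: "irreflp lt" "transp lt" "totalp lt" and fin: "\<And>a. finite {b. lt b a}"
  shows "\<exists>\<pi>. order_iso \<pi> lt"
proof -
  define r where "r a = card {b. lt b a}" for a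
  have less: "r a < r c" if "lt a c" for a c
    unfolding r_def using that irreflpD[OF lt(1), of a] transpD[OF lt(2), of _ a c]
    by (intro psubset_card_mono fin) auto
  have less_iff: "lt a c \<longleftrightarrow> r a < r c" for a c
    using less lt(3) by (metis less_asym less_irrefl totalpD)
  have inj: "inj r"
    using less lt(3) by (metis injI less_irrefl totalpD)
  have "n \<in> range r" for n
  proof -
    have "\<not> range r \<subseteq> {..n}"
      using finite_subset[of "range r" "{..n}"] finite_imageD[OF _ inj] by auto
    then obtain a where "n < r a" by (meson atMost_iff image_subsetI not_le_imp_less)
    then have "n \<in> (\<lambda>c. card {b \<in> {b. lt b a}. lt b c}) ` {b. lt b a}"
      using bij_betw_card_below[OF fin lt, of a] unfolding r_def by (simp add: bij_betw_def)
    then obtain c where c: "lt c a" "n = card {b \<in> {b. lt b a}. lt b c}" by blast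
    \<comment> \<open>By transitivity, counting inside the initial segment below \<open>a\<close>
      misses no predecessor of \<open>c\<close>.\<close>
    moreover have "{b \<in> {b. lt b a}. lt b c} = {b. lt b c}"
      using transpD[OF lt(2) _ c(1)] by auto
    ultimately show ?thesis by (auto simp: r_def)
  qed
  with inj have bij: "bij r" by (auto simp: bij_def)
  then have "order_iso (inv r) lt"
    unfolding order_iso_def
    by (simp add: bij_imp_bij_inv less_iff bij_is_surj surj_f_inv_f)
  then show ?thesis by blast
qed

subsection \<open>Computing ranks from the image of the graph\<close>

text \<open>In the application \<open>S i\<close> is the true rank of the element that looks like
  the i-th one at stage \<open>s\<close>. Monotonicity is assumed only below \<open>s\<close>, so
  the argument has to stay inside the closed segment of length \<open>k\<close>; the bound
  \<open>i \<le> h k\<close> keeps there every point that \<open>f\<close> sends below the least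
  displaced one.\<close>

lemma embedding_fixed:
  fixes f h S :: "nat \<Rightarrow> nat"
  assumes mono_S: "\<And>i j. i < j \<Longrightarrow> j < s \<Longrightarrow> S i < S j"
    and k: "k \<le> s" and closed: "\<And>i. i < k \<Longrightarrow> f i < k"
    and commute: "\<And>i. i < k \<Longrightarrow> f (S i) = S (f i)"
    and start: "\<And>i. i \<le> a \<Longrightarrow> i < s \<Longrightarrow> S i = i"
    and escape: "\<And>m. a < m \<Longrightarrow> (\<forall>i<m. f i < m) \<Longrightarrow> \<exists>x\<ge>m. f x < m"
    and h: "mono h" "\<And>n. h n \<le> f n"
    and i: "i < k" "i \<le> h k"
  shows "S i = i"
proof (rule ccontr)
  assume "S i \<noteq> i"
  define m where "m = (LEAST m. S m \<noteq> m)"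
  have Sm: "S m \<noteq> m" and below: "\<And>j. j < m \<Longrightarrow> S j = j"
    unfolding m_def using LeastI[of "\<lambda>m. S m \<noteq> m", OF \<open>S i \<noteq> i\<close>]
      not_less_Least[of _ "\<lambda>m. S m \<noteq> m"] by blast+
  have "m \<le> i" unfolding m_def by (rule Least_le) fact
  then have m: "m < k" "m \<le> h k" using i by auto
  have ge: "j \<le> S j" if "j < s" for j
    using that
  proof (induction j)
    case (Suc j)
    then show ?case using mono_S[of j "Suc j"] by linarith
  qed simp
  have gt: "j < S j" if "m \<le> j" "j < s" for j
    using that
  proof (induction j rule: dec_induct)
    case base
    then show ?case using ge[of m] Sm by simp
  next
    case (step j)
    then show ?case using mono_S[of j "Suc j"] by linarith
  qed
  \<comment> \<open>As \<open>j\<close> is fixed, commuting shows that \<open>S\<close> also fixes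
    \<open>f j\<close>, whereas it displaces every point of the segment from \<open>m\<close>
    on.\<close>
  have "\<forall>j<m. f j < m"
  proof (intro allI impI)
    fix j assume "j < m"
    then have "S (f j) = f j" using commute[of j] below[of j] m by simp
    moreover have "f j < s" using closed[of j] \<open>j < m\<close> m k by simp
    ultimately show "f j < m" using gt[of "f j"] by (metis less_irrefl not_le_imp_less)
  qed
  moreover have "a < m" using start[of m] Sm m k by (meson le_less_trans less_le_trans not_le)
  ultimately obtain x where x: "m \<le> x" "f x < m" using escape by blast
  define X where "X = {x. m \<le> x \<and> f x < m}"
  \<comment> \<open>From \<open>k\<close> on, the values of \<open>f\<close> are at least
    \<open>h k\<close>, hence at least \<open>m\<close>.\<close>
  have X_less: "x < k" if "x \<in> X" for x
  proof (rule ccontr)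
    assume "\<not> x < k"
    then have "h k \<le> f x" using h(2)[of x] monoD[OF h(1), of k x] by simp
    with that m show False by (simp add: X_def)
  qed
  then have fin: "finite X" using finite_subset[of X "{..<k}"] by auto
  have "Max X \<in> X" using x fin by (intro Max_in) (auto simp: X_def)
  then have M: "m \<le> Max X" "f (Max X) < m" "Max X < k"
    using X_less by (auto simp: X_def)
  \<comment> \<open>Commuting gives \<open>f (S (Max X)) = S (f (Max X))\<close>, and
    \<open>S\<close> fixes \<open>f (Max X)\<close> because it lies below \<open>m\<close>.\<close>
  then have "f (S (Max X)) < m" "Max X < S (Max X)"
    using commute[of "Max X"] below[of "f (Max X)"] gt[of "Max X"] k by auto
  then have "S (Max X) \<in> X" using M by (simp add: X_def)
  then show False using Max_ge[OF fin] \<open>Max X < S (Max X)\<close> by (meson not_le)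
qed

text \<open>Let \<open>a\<close> lie in no finite interval closed under \<open>f\<close> and
  preimages. An initial segment that contains \<open>a\<close> and is closed under \<open>f\<close>
  must then fail for preimages, so some point outside it is mapped into it.\<close>

lemma not_block_escape:
  assumes "\<not> block f"
  obtains a where "\<And>m. a < m \<Longrightarrow> (\<forall>i<m. f i < m) \<Longrightarrow> \<exists>x\<ge>m. f x < m"
proof -
  obtain a where a: "\<And>l u. a \<in> {l..u} \<Longrightarrow> \<not> (\<forall>x\<in>{l..u}. f x \<in> {l..u} \<and> f -` {x} \<subseteq> {l..u})"
    using assms unfolding block_def by blast
  have "\<exists>x\<ge>m. f x < m" if m: "a < m" "\<forall>i<m. f i < m" for m
  proof -
    have "{0..m - 1} = {..<m}" using m(1) by auto
    then have "\<not> (\<forall>x\<in>{..<m}. f x \<in> {..<m} \<and> f -` {x} \<subseteq> {..<m})"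
      using a[of 0 "m - 1"] m(1) by simp
    then show ?thesis using m(2) by (auto simp: not_less)
  qed
  then show thesis using that by blast
qed

section \<open>True ranks in a computable copy and their approximations\<close>

locale omega_copy =
  fixes lt :: "nat \<Rightarrow> nat \<Rightarrow> bool" and \<pi> :: "nat \<Rightarrow> nat"
  assumes computable: "computable_rel lt" and iso: "order_iso \<pi> lt"
begin

definition rank :: "nat \<Rightarrow> nat" where "rank = inv \<pi>"

lemma bij: "bij \<pi>"
  using iso by (simp add: order_iso_def)

lemma rank_pi [simp]: "rank (\<pi> x) = x"
  using bij by (simp add: rank_def bij_is_inj)

lemma pi_rank [simp]: "\<pi> (rank a) = a"
  using bij by (simp add: rank_def bij_is_surj surj_f_inv_f)

lemma rank_eq_iff [simp]: "rank a = rank b \<longleftrightarrow> a = b"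
  by (metis pi_rank)

lemma lt_iff: "lt a b \<longleftrightarrow> rank a < rank b"
  using iso unfolding order_iso_def by (metis pi_rank)

lemma order_props: "irreflp lt" "transp lt" "totalp lt"
  by (auto simp: lt_iff irreflp_def transp_def totalp_on_def neq_iff[of "rank _", symmetric])

lemma below_eq: "{b. lt b a} = \<pi> ` {..<rank a}"
  by (auto simp: lt_iff image_iff) (metis lessThan_iff pi_rank)

lemma card_below: "card {b. lt b a} = rank a"
  using bij by (simp add: below_eq card_image[OF inj_on_subset[OF bij_is_inj]])

lemma finite_below: "finite {b. lt b a}"
  by (simp add: below_eq)

lemma rank_below_le: "rank_below lt s a \<le> rank a"
  unfolding rank_below_def card_below[symmetric] by (rule card_mono[OF finite_below]) auto

text \<open>The right-hand side persists as \<open>s\<close> grows: an approximation that is exact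
  once remains exact. It also turns any bound on the predecessors of \<open>a\<close> into a
  computation of its rank.\<close>

lemma rank_below_eq_iff: "rank_below lt s a = rank a \<longleftrightarrow> (\<forall>b. lt b a \<longrightarrow> b < s)"
proof
  assume "rank_below lt s a = rank a"
  then have "{b. b < s \<and> lt b a} = {b. lt b a}"
    unfolding rank_below_def card_below[symmetric]
    by (intro card_subset_eq finite_below) auto
  then show "\<forall>b. lt b a \<longrightarrow> b < s" by auto
next
  assume "\<forall>b. lt b a \<longrightarrow> b < s"
  then have "{b. b < s \<and> lt b a} = {b. lt b a}" by auto
  then show "rank_below lt s a = rank a" by (simp add: rank_below_def card_below)
qed

text \<open>Only finitely many elements have rank at most \<open>c\<close>, and their predecessors
  are among them; a stage past all of them is exact for each.\<close>

lemma rank_below_eventually: "\<exists>s\<ge>n. \<forall>a. rank a \<le> c \<longrightarrow> a < s \<and> rank_below lt s a = rank a"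
proof -
  define s where "s = n + Suc (Max (\<pi> ` {..c}))"
  have less: "a < s" if "rank a \<le> c" for a
    using Max_ge[of "\<pi> ` {..c}" a] that image_eqI[of a \<pi> "rank a" "{..c}"]
    by (simp add: s_def less_Suc_eq_le trans_le_add2)
  then have "rank_below lt s a = rank a" if "rank a \<le> c" for a
    using that by (auto simp: rank_below_eq_iff lt_iff)
  with less show ?thesis by (intro exI[of _ s]) (simp add: s_def)
qed

lemma bij_betw_rank_below: "bij_betw (rank_below lt s) {..<s} {..<s}"
  using bij_betw_card_below[of "{..<s}" lt, OF _ order_props]
  by (simp add: rank_below_def[abs_def])

lemma rank_below_mono: "rank a \<le> rank b \<Longrightarrow> rank_below lt s a \<le> rank_below lt s b"
  unfolding rank_below_def by (rule card_mono) (auto simp: lt_iff)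

text \<open>The region strictly below the graph of \<open>rank\<close>, coded as a set so that it
  can serve as an oracle. Approximations from below can confirm membership in it.\<close>

definition cut_set :: "nat set" where
  "cut_set = {z. fst (prod_decode z) < rank (snd (prod_decode z))}"

lemma cut_set_le:
  assumes "recfun A [\<lambda>x. x] rank"
  shows "cut_set \<le>\<^sub>T A"
  unfolding turing_le_iff cut_set_def mem_Collect_eq
  by (intro rec_intros recfun_comp1[OF assms] recfun_fst_prod_decode recfun_snd_prod_decode;
      (rule recfun_var, simp))

lemma rank_recfun_cut_set: "recfun cut_set [\<lambda>x. x] rank"
proof -
  have "rank a = (LEAST x. prod_encode (x, a) \<notin> cut_set)" for a
    by (rule Least_equality[symmetric]) (auto simp: cut_set_def)
  moreover have "recfun cut_set [\<lambda>x. x] (\<lambda>a. LEAST x. prod_encode (x, a) \<notin> cut_set)"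
  proof (rule recfun_Least)
    show "\<exists>x. prod_encode (x, a) \<notin> cut_set" for a
      by (rule exI[of _ "rank a"]) (simp add: cut_set_def)
  qed (intro rec_intros recfun_prod_encode; (rule recfun_var, simp))
  ultimately show ?thesis by presburger
qed

lemma ce_cut_set: "ce cut_set"
proof -
  \<comment> \<open>A fixed member of the set, output whenever the test fails. The input of
    \<open>g\<close> codes a candidate together with a stage.\<close>
  define w where "w = prod_encode (0, \<pi> 1)"
  define g where "g z = (let c = fst (prod_decode z) in
    if fst (prod_decode c) < rank_below lt (snd (prod_decode z)) (snd (prod_decode c))
    then c else w)" for z
  have "computable_fun g"
    unfolding computable_fun_iff g_def Let_def
    by (intro rec_intros recfun_if recfun_rank_below[OF computable] recfun_fst_prod_decode
        recfun_snd_prod_decode; (rule recfun_var, simp))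
  moreover have "cut_set = range g"
  proof (intro equalityI subsetI)
    fix c assume c: "c \<in> cut_set"
    obtain s where "rank_below lt s (snd (prod_decode c)) = rank (snd (prod_decode c))"
      using rank_below_eventually[of 0 "rank (snd (prod_decode c))"] by auto
    with c have "g (prod_encode (c, s)) = c" by (simp add: g_def cut_set_def)
    then show "c \<in> range g" by (metis rangeI)
  next
    have "w \<in> cut_set" by (simp add: w_def cut_set_def)
    then show "c \<in> cut_set" if "c \<in> range g" for c
      using that rank_below_le by (auto simp: g_def Let_def cut_set_def split: if_splits
          intro: less_le_trans)
  qed
  ultimately show ?thesis unfolding ce_def by blast
qed

section \<open>The image of the graph and the rank function compute each other\<close>

lemma mem_graph_image:
  "prod_encode (a, b) \<in> graph_image \<pi> f \<longleftrightarrow> rank b = f (rank a)"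
  unfolding graph_image_def by auto (metis pi_rank)

lemma graph_image_le:
  assumes "computable_fun f" "recfun A [\<lambda>x. x] rank"
  shows "graph_image \<pi> f \<le>\<^sub>T A"
proof -
  have "z \<in> graph_image \<pi> f \<longleftrightarrow> rank (snd (prod_decode z)) = f (rank (fst (prod_decode z)))" for z
    by (metis mem_graph_image prod.collapse prod_decode_inverse)
  then show ?thesis
    unfolding turing_le_iff
    by simp (intro rec_intros recfun_comp1[OF assms(2)] recfun_computable[OF assms(1)]
        recfun_fst_prod_decode recfun_snd_prod_decode; (rule recfun_var, simp))
qed

lemma rank_recfun_graph_image:
  assumes f: "computable_fun f" and h: "computable_fun h" "mono h" "\<And>n. h n \<le> f n"
    "filterlim h at_top sequentially"
    and pqb: "proper_quasi_block f"
  shows "recfun (graph_image \<pi> f) [\<lambda>x. x] rank"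
proof -
  let ?G = "graph_image \<pi> f" and ?r = "rank_below lt"
  obtain c where escape: "\<And>m. c < m \<Longrightarrow> (\<forall>i<m. f i < m) \<Longrightarrow> \<exists>x\<ge>m. f x < m"
    using not_block_escape pqb unfolding proper_quasi_block_def by blast
  \<comment> \<open>Finite information: \<open>s0\<close> enters the program as a constant, and from
    this stage on the elements of rank at most \<open>c\<close> have their true ranks.\<close>
  obtain s0 where s0: "\<And>a s. rank a \<le> c \<Longrightarrow> s0 \<le> s \<Longrightarrow> a < s \<and> ?r s a = rank a"
  proof -
    obtain s0 where s0: "\<forall>a. rank a \<le> c \<longrightarrow> a < s0 \<and> ?r s0 a = rank a"
      using rank_below_eventually[of 0 c] by blast
    have "a < s \<and> ?r s a = rank a" if "rank a \<le> c" "s0 \<le> s" for a s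
      using s0 that unfolding rank_below_eq_iff by (meson less_le_trans)
    then show thesis using that by blast
  qed
  define good where "good s k \<longleftrightarrow> (\<forall>i<k. f i < k) \<and>
    (\<forall>u<s. \<forall>v<s. ?r s u < k \<and> ?r s v = f (?r s u) \<longrightarrow> prod_encode (u, v) \<in> ?G)" for s k
  \<comment> \<open>The bound \<open>k \<le> s\<close> makes the search for \<open>k\<close> finite
    and ensures that every position below \<open>k\<close> is occupied at stage
    \<open>s\<close>.\<close>
  define stage where "stage a s \<longleftrightarrow> s0 \<le> s \<and> a < s \<and>
    (\<exists>k<Suc s. good s k \<and> ?r s a < k \<and> ?r s a \<le> h k)" for a s
  have correct: "?r s a = rank a" if stage: "stage a s" for a s
  proof -
    obtain k where k: "k \<le> s" "good s k" "?r s a < k" "?r s a \<le> h k" and s: "s0 \<le> s" "a < s"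
      using stage by (auto simp: stage_def less_Suc_eq_le)
    \<comment> \<open>The numbers below \<open>s\<close>, listed in the order of the copy.\<close>
    define g where "g = inv_into {..<s} (?r s)"
    have g: "g i < s" "?r s (g i) = i" if "i < s" for i
      using that bij_betw_rank_below[of s] inv_into_into[of i "?r s" "{..<s}"]
      by (auto simp: g_def bij_betw_def f_inv_into_f)
    have g_eq: "g (?r s b) = b" if "b < s" for b
      using that bij_betw_rank_below[of s] by (simp add: g_def bij_betw_def)
    have "rank (g (?r s a)) = ?r s a"
    proof (rule embedding_fixed[where S = "\<lambda>i. rank (g i)" and a = c and s = s and f = f
            and h = h and k = k])
      show "rank (g i) < rank (g j)" if "i < j" "j < s" for i j
      proof (rule ccontr)
        assume "\<not> rank (g i) < rank (g j)"
        then have "?r s (g j) \<le> ?r s (g i)" by (intro rank_below_mono) simp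
        with that g show False by simp
      qed
      show "f i < k" if "i < k" for i using k(2) that by (auto simp: good_def)
      then have "f i < s" if "i < k" for i using that k(1) by (meson less_le_trans)
      then have "prod_encode (g i, g (f i)) \<in> ?G" if "i < k" for i
        using k(1,2) that g[of i] g[of "f i"] by (simp add: good_def)
      then show "f (rank (g i)) = rank (g (f i))" if "i < k" for i
        using that by (simp add: mem_graph_image)
      show "rank (g i) = i" if "i \<le> c" "i < s" for i
        using s0[of "\<pi> i" s] that s g_eq[of "\<pi> i"] by simp
    qed (use escape h k in auto)
    then show ?thesis using g_eq s by simp
  qed
  have ex: "\<exists>s. stage a s" for a
  proof -
    \<comment> \<open>For the search to succeed, take \<open>k\<close> closed, beyond
      \<open>rank a\<close> and so large that \<open>h k\<close> reaches \<open>rank a\<close>; then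
      take a stage at which all ranks up to \<open>k\<close> are exact.\<close>
    obtain n where n: "\<And>k. n \<le> k \<Longrightarrow> rank a \<le> h k"
      using h(4) unfolding filterlim_at_top eventually_sequentially by blast
    obtain k where k: "max n (Suc (rank a)) \<le> k" "f ` {..<k} \<subseteq> {..<k}"
      using pqb unfolding proper_quasi_block_def quasi_block_def by blast
    then have closed: "f i < k" if "i < k" for i using that by auto
    obtain s where s: "max s0 k \<le> s" and eq: "\<And>b. rank b \<le> k \<Longrightarrow> b < s \<and> ?r s b = rank b"
      using rank_below_eventually[of "max s0 k" k] by blast
    \<comment> \<open>The element whose true rank is \<open>?r s u\<close> shows this rank at stage
      \<open>s\<close> too; approximate ranks being injective below \<open>s\<close>, it is
      \<open>u\<close>.\<close>
    have eq': "?r s u = rank u" if "u < s" "?r s u < k" for u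
    proof -
      let ?w = "\<pi> (?r s u)"
      have "?w < s" "?r s ?w = ?r s u" using eq[of ?w] that by auto
      then have "?w = u"
        using bij_betw_rank_below[of s] that by (auto simp: bij_betw_def inj_on_def)
      then show ?thesis by (metis rank_pi)
    qed
    have "good s k"
      unfolding good_def using closed eq' by (metis mem_graph_image)
    then have "stage a s"
      unfolding stage_def using s k n eq[of a] by (auto intro!: exI[of _ k])
    then show ?thesis ..
  qed
  have "rank a = ?r (LEAST s. stage a s) a" for a
    using correct[OF LeastI_ex[OF ex]] by simp
  moreover have "recfun ?G [\<lambda>x. x] (\<lambda>a. ?r (LEAST s. stage a s) a)"
  proof (intro recfun_rank_below[OF computable] recfun_Least ex)
    show "recpred ?G (snd # map (\<lambda>v p. v (fst p)) [\<lambda>x. x]) (\<lambda>p. stage (fst p) (snd p))"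
      unfolding stage_def good_def
      by (intro rec_intros recfun_computable[OF f] recfun_computable[OF h(1)]
          recfun_rank_below[OF computable] recfun_prod_encode; (rule recfun_var, simp))
  qed (rule recfun_var, simp)
  ultimately show ?thesis by presburger
qed

lemma turing_degree_graph_image:
  assumes "computable_fun f" "computable_fun h" "mono h" "\<And>n. h n \<le> f n"
    "filterlim h at_top sequentially" "proper_quasi_block f"
  shows "turing_degree (graph_image \<pi> f) = turing_degree cut_set"
  by (intro turing_degree_eqI graph_image_le rank_recfun_cut_set cut_set_le assms(1)
      rank_recfun_graph_image[OF assms])

end

subsection \<open>Realising a c.e. degree\<close>

lemma recfun_half:
  assumes "recfun A vs X"
  shows "recfun A vs (\<lambda>e. X e div 2)"
proof (rule recfun_comp1[OF _ assms])
  have half: "x div 2 = (LEAST m. x < Suc (Suc (m + m)))" for x :: nat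
    by (rule Least_equality[symmetric]) auto
  have "recfun A [\<lambda>x. x] (\<lambda>x. LEAST m. x < Suc (Suc (m + m)))"
  proof (rule recfun_Least)
    show "\<exists>m. x < Suc (Suc (m + m))" for x :: nat by (rule exI[of _ x]) simp
  qed (intro rec_intros; (rule recfun_var, simp))
  then show "recfun A [\<lambda>x. x] (\<lambda>x. x div 2)" by (simp only: half)
qed

text \<open>The number of the block that receives \<open>a\<close>. A block k has at most three
  elements: 2k, possibly 2k + 1, and 2t + 1 for the first t with g t = k, if there is one.\<close>

definition key :: "(nat \<Rightarrow> nat) \<Rightarrow> nat \<Rightarrow> nat" where
  "key g a = (if even a \<or> (\<exists>t<a div 2. g t = g (a div 2)) then a div 2 else g (a div 2))"

definition key_less :: "(nat \<Rightarrow> nat) \<Rightarrow> nat \<Rightarrow> nat \<Rightarrow> bool" where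
  "key_less g a b \<longleftrightarrow> key g a < key g b \<or> key g a = key g b \<and> a < b"

text \<open>The modulus of the enumeration \<open>g\<close>. It is computable from
  \<open>range g\<close> and serves to bound the elements of the blocks up to
  \<open>k\<close>.\<close>

definition settling_stage :: "(nat \<Rightarrow> nat) \<Rightarrow> nat \<Rightarrow> nat" where
  "settling_stage g k = (LEAST s. \<forall>n<Suc k. n \<in> range g \<longrightarrow> (\<exists>t<s. g t = n))"

lemma settling_stage_exists: "\<exists>s. \<forall>n<k. n \<in> range g \<longrightarrow> (\<exists>t<s. g t = n)"
  for g :: "nat \<Rightarrow> nat"
proof (rule exI[of _ "Suc (Max (inv g ` {..<k}))"], intro allI impI)
  fix n assume "n < k" "n \<in> range g"
  then have "inv g n \<le> Max (inv g ` {..<k})" "g (inv g n) = n"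
    by (auto intro: Max_ge f_inv_into_f)
  then show "\<exists>t<Suc (Max (inv g ` {..<k})). g t = n" by (auto simp: less_Suc_eq_le)
qed

lemma settling_stageD:
  assumes "g u \<le> k"
  shows "\<exists>t<settling_stage g k. g t = g u"
  using LeastI_ex[OF settling_stage_exists[of "Suc k" g]] assms
  unfolding settling_stage_def by (simp add: less_Suc_eq_le)

text \<open>If \<open>a\<close> is not in the block of its half, then it marks a first enumeration
  of a number at most \<open>k\<close>, which happens before the settling stage. Halving loses at
  most 1, hence the bound of twice the sum plus 2.\<close>

lemma key_le_imp_less:
  assumes "key g a \<le> k"
  shows "a < Suc (Suc ((settling_stage g k + k) + (settling_stage g k + k)))"
proof -
  have "a div 2 \<le> settling_stage g k + k"
  proof (cases "key g a = a div 2")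
    case False
    then have new: "key g a = g (a div 2)" "\<And>t. t < a div 2 \<Longrightarrow> g t \<noteq> g (a div 2)"
      by (auto simp: key_def split: if_splits)
    obtain t where "t < settling_stage g k" "g t = g (a div 2)"
      using settling_stageD[of g "a div 2" k] assms new(1) by auto
    then show ?thesis using new(2)[of t] by (meson le_add1 le_trans less_imp_le not_le)
  qed (use assms in simp)
  then show ?thesis by linarith
qed

lemma ce_degree_cut_set:
  assumes "ce W"
  shows "\<exists>lt \<pi>. omega_copy lt \<pi> \<and> turing_degree (omega_copy.cut_set \<pi>) = turing_degree W"
proof -
  obtain g where g: "computable_fun g" and W: "turing_degree W = turing_degree (range g)"
  proof (cases "W = {}")
    \<comment> \<open>The empty set is replaced by {0}, which has the same degree and is the range
      of a function.\<close>
    case True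
    have "computable_fun (\<lambda>_. 0)"
      unfolding computable_fun_iff by (rule recfun_const)
    moreover have "range (\<lambda>_. 0 :: nat) \<le>\<^sub>T {}"
      unfolding turing_le_iff by simp (intro rec_intros; (rule recfun_var, simp))
    ultimately show thesis
      using that True turing_degree_eqI[OF empty_turing_le] by blast
  qed (use assms that in \<open>auto simp: ce_def\<close>)
  let ?lt = "key_less g"
  have key: "recfun A vs (\<lambda>e. key g (X e))" if "recfun A vs X" for A X
    and vs :: "('e \<Rightarrow> nat) list"
  proof (rule recfun_comp1[OF _ that])
    have "even a \<longleftrightarrow> a div 2 + a div 2 = a" for a :: nat by presburger
    then show "recfun A [\<lambda>x. x] (key g)"
      unfolding key_def[abs_def]
      by (simp only:) (intro rec_intros recfun_if recfun_computable[OF g] recfun_half;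
          (rule recfun_var, simp))
  qed
  have computable: "computable_rel ?lt"
    unfolding computable_rel_iff key_less_def
    by (intro rec_intros key; (rule recfun_var, simp))
  define bound where
    "bound k = Suc (Suc ((settling_stage g k + k) + (settling_stage g k + k)))" for k
  have less_bound: "b < bound (key g a)" if "?lt b a" for a b
    using key_le_imp_less[of g b "key g a"] that by (auto simp: key_less_def bound_def)
  have "finite {b. ?lt b a}" for a
    by (rule finite_subset[of _ "{..<bound (key g a)}"]) (auto dest: less_bound)
  moreover have "irreflp ?lt" "transp ?lt" "totalp ?lt"
    by (auto simp: irreflp_def transp_def totalp_on_def key_less_def)
  ultimately obtain \<pi> where "order_iso \<pi> ?lt" using order_iso_exists by blast
  then interpret omega_copy ?lt \<pi> using computable by unfold_locales
  have "cut_set \<le>\<^sub>T range g"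
  proof (rule cut_set_le)
    \<comment> \<open>All predecessors of \<open>a\<close> lie below a bound that the oracle
      computes, so the approximation at that stage is exact.\<close>
    have "rank a = rank_below ?lt (bound (key g a)) a" for a
      using rank_below_eq_iff[of "bound (key g a)" a] less_bound by simp
    moreover have "recfun (range g) [\<lambda>x. x] (\<lambda>a. rank_below ?lt (bound (key g a)) a)"
    proof -
      have settling: "recfun (range g) [\<lambda>x. x] (settling_stage g)"
        unfolding settling_stage_def[abs_def]
        by (rule recfun_Least[OF _ settling_stage_exists])
          (intro rec_intros recfun_computable[OF g]; (rule recfun_var, simp))
      show ?thesis
        unfolding bound_def
        by (intro rec_intros recfun_rank_below[OF computable] recfun_comp1[OF settling] key;
            (rule recfun_var, simp))
    qed
    ultimately show "recfun (range g) [\<lambda>x. x] rank" by presburger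
  qed
  moreover have "range g \<le>\<^sub>T cut_set"
  proof -
    \<comment> \<open>The element 2n + 2 lies in block n + 1. If n is first enumerated at t, then 2t
      + 1 lies in block n and precedes it, so exactness of its rank forces 2t + 1, and hence t,
      below the stage.\<close>
    define stage where
      "stage n = (LEAST s. rank_below ?lt s (Suc (Suc (n + n))) = rank (Suc (Suc (n + n))))" for n
    have ex: "\<exists>s. rank_below ?lt s a = rank a" for a
      using rank_below_eventually[of 0 "rank a"] by blast
    have "n \<in> range g \<longleftrightarrow> (\<exists>t<stage n. g t = n)" for n
    proof
      assume "n \<in> range g"
      then obtain t where t: "g t = n" "\<And>u. u < t \<Longrightarrow> g u \<noteq> n"
        using exists_least_iff[of "\<lambda>t. g t = n"] by blast
      then have "key g (Suc (t + t)) = n"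
        by (auto simp: key_def)
      moreover have "key g (Suc (Suc (n + n))) = Suc n"
        by (auto simp: key_def)
      ultimately have "?lt (Suc (t + t)) (Suc (Suc (n + n)))" by (simp add: key_less_def)
      then have "Suc (t + t) < stage n"
        using LeastI_ex[OF ex[of "Suc (Suc (n + n))"]]
        unfolding stage_def rank_below_eq_iff by blast
      then show "\<exists>t<stage n. g t = n" using t(1) by (intro exI[of _ t]) simp
    qed auto
    moreover have "recfun cut_set [\<lambda>x. x] stage"
      unfolding stage_def[abs_def]
      by (rule recfun_Least[OF _ ex]) (intro rec_intros recfun_rank_below[OF computable]
          recfun_comp1[OF rank_recfun_cut_set]; (rule recfun_var, simp))
    ultimately show ?thesis
      unfolding turing_le_iff
      by (simp only:) (intro rec_intros recfun_computable[OF g]; (assumption | rule recfun_var, simp))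
  qed
  ultimately have "turing_degree cut_set = turing_degree W"
    unfolding W by (rule turing_degree_eqI)
  then show ?thesis using omega_copy_axioms by blast
qed

theorem theorem5:
  fixes f h :: "nat \<Rightarrow> nat"
  assumes "computable_fun f"
    and "proper_quasi_block f"
    and "computable_fun h"
    and "mono h"
    and "\<And>n. h n \<le> f n"
    and "filterlim h at_top sequentially"
  shows "degree_spectrum f = ce_degrees"
proof -
  have deg: "turing_degree (graph_image \<pi> f) = turing_degree (omega_copy.cut_set \<pi>)"
    if "omega_copy lt \<pi>" for lt \<pi>
    using omega_copy.turing_degree_graph_image[OF that] assms by blast
  show ?thesis
  proof (intro equalityI subsetI)
    fix d assume "d \<in> degree_spectrum f"
    then obtain \<pi> lt where "d = turing_degree (graph_image \<pi> f)" "omega_copy lt \<pi>"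
      unfolding degree_spectrum_def computable_copy_def omega_copy_def by blast
    then show "d \<in> ce_degrees"
      using deg omega_copy.ce_cut_set unfolding ce_degrees_def by blast
  next
    fix d assume "d \<in> ce_degrees"
    then obtain W where "ce W" "d = turing_degree W" unfolding ce_degrees_def by blast
    then obtain lt \<pi> where "omega_copy lt \<pi>" "d = turing_degree (graph_image \<pi> f)"
      using ce_degree_cut_set deg by metis
    then show "d \<in> degree_spectrum f"
      unfolding degree_spectrum_def computable_copy_def omega_copy_def by blast
  qed
qed

end
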